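(* Let $d\ge 2$, let $q\equiv 1\pmod d$ be a prime power, let $S_d=\{x^d:x\in\mathbb{F}_q^*\}$, let $A'\subset\mathbb{F}_q^*$ and $\lambda\in\mathbb{F}_q^*$. If $ab+\lambda\in S_d\cup\{0\}$ for all $a,b\in A'$ with $a\ne b$, while there exist $a,b\in A'$ (not necessarily distinct) with $ab+\lambda\notin S_d\cup\{0\}$, then $|A'|\le\sqrt{2(q-1)/d}+4$. *)

theory Defs
  imports "HOL-Number_Theory.Cong" "HOL-Library.Cardinality" Complex_Main
begin

definition dth_powers :: "nat \<Rightarrow> 'a::field set" where
  "dth_powers d = {x ^ d |x. x \<noteq> 0}"

end

theory Submission
  imports Defs "HOL-Computational_Algebra.Polynomial"
begin

text \<open>
  The proof is a variant of Stepanov's method. Write \<open>m = (q - 1) / d\<close>, so that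
  \<open>S\<^sub>d\<close> is the set of roots of \<open>X\<^sup>m - 1\<close>, and let
  \<open>w(a) = \<Prod>\<^bsub>c \<noteq> a\<^esub> (a - c)\<inverse>\<close> be the divided-difference weights of \<open>A'\<close>,
  so that \<open>\<Sum>\<^bsub>a\<^esub> w(a) P(a) = 0\<close> for every polynomial \<open>P\<close> of degree at most \<open>|A'| - 2\<close>.
  Consider
  \<open>f(X) = \<Sum>\<^bsub>a\<^esub> w(a) (a X + \<lambda>)\<^bsup>m+r+1\<^esup> (X - a)\<^sup>r\<close> with \<open>2 r + 3 \<le> |A'|\<close>.
  In the Taylor expansion of \<open>f\<close> at \<open>b \<in> A'\<close> up to order \<open>r\<close>, the factors \<open>(a b + \<lambda>)\<^sup>m\<close>
  with \<open>a \<noteq> b\<close> may be dropped, and then every coefficient is a weighted sum that vanishes. The only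
  obstruction is the summand \<open>a = b\<close>, which the factor \<open>(X - a)\<^sup>r\<close> suppresses below order \<open>r\<close>.
  Hence \<open>f\<close> vanishes to order \<open>r\<close> at each point of \<open>A'\<close>. At an element \<open>b\<close> with
  \<open>b\<^sup>2 + \<lambda> \<notin> S\<^sub>d \<union> {0}\<close> the coefficient of order \<open>r\<close> does not vanish, so \<open>f \<noteq> 0\<close> and
  \<open>r |A'| \<le> deg f \<le> m + 2 r + 1\<close>.
\<close>

definition divdiff_weight :: "'a::field set \<Rightarrow> 'a \<Rightarrow> 'a" where
  "divdiff_weight A a = inverse (\<Prod>c\<in>A - {a}. a - c)"

lemma divdiff_weight_nonzero: "finite A \<Longrightarrow> divdiff_weight A a \<noteq> 0"
  by (simp add: divdiff_weight_def)

text \<open>\<open>Q\<close> is the Lagrange interpolant of \<open>P\<close> on \<open>A\<close>.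
  Both have degree below \<open>card A\<close>, so they coincide, and the sum is the coefficient of
  \<open>Q\<close> in degree \<open>card A - 1\<close>, which exceeds
  \<open>degree P\<close>.\<close>

lemma sum_divdiff_weight_eq_0:
  fixes P :: "'a::field poly"
  assumes fin: "finite A" and deg: "degree P + 2 \<le> card A"
  shows "(\<Sum>a\<in>A. divdiff_weight A a * poly P a) = 0"
proof -
  define L where "L a = (\<Prod>c\<in>A - {a}. [:- c, 1:])" for a
  define Q where "Q = (\<Sum>a\<in>A. smult (divdiff_weight A a * poly P a) (L a))"
  have degL: "degree (L a) = card A - 1" if "a \<in> A" for a
    unfolding L_def using that fin by (subst degree_prod_sum_eq) auto
  have coeffL: "coeff (L a) (card A - 1) = 1" if "a \<in> A" for a
    using lead_coeff_prod[of "\<lambda>c. [:- c, 1:]" "A - {a}"] degL[OF that] by (simp add: L_def)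
  have "degree Q \<le> card A - 1"
    unfolding Q_def using fin degL
    by (intro degree_sum_le) (auto intro: order.trans[OF degree_smult_le])
  hence degQ: "degree Q < card A" using deg by linarith
  have "poly Q b = poly P b" if b: "b \<in> A" for b
  proof -
    have zero: "poly (L a) b = 0" if "a \<in> A - {b}" for a
      using that b fin by (auto simp: L_def poly_prod prod_zero_iff)
    have "poly Q b = (\<Sum>a\<in>A. divdiff_weight A a * poly P a * poly (L a) b)"
      by (simp add: Q_def poly_sum)
    also have "\<dots> = divdiff_weight A b * poly P b * poly (L b) b"
      using fin b zero by (subst sum.remove[of _ b]) auto
    also have "poly (L b) b = (\<Prod>c\<in>A - {b}. b - c)"
      by (simp add: L_def poly_prod)
    also have "divdiff_weight A b * poly P b * \<dots> = poly P b"
      using fin by (simp add: divdiff_weight_def field_simps)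
    finally show ?thesis .
  qed
  hence "Q = P"
    using deg degQ by (intro poly_eqI_degree[of A]) auto
  hence "coeff Q (card A - 1) = 0"
    using deg by (simp add: coeff_eq_0)
  thus ?thesis
    by (simp add: Q_def coeff_sum coeffL del: One_nat_def)
qed

definition stepanov_poly :: "'a::field set \<Rightarrow> 'a \<Rightarrow> nat \<Rightarrow> nat \<Rightarrow> 'a poly" where
  "stepanov_poly A lam n r =
     (\<Sum>a\<in>A. smult (divdiff_weight A a) ([:lam, a:] ^ n * [:- a, 1:] ^ r))"

lemma pcompose_power: "pcompose (p ^ n) r = pcompose p r ^ n"
  for p r :: "'a::comm_semiring_1 poly"
  by (induction n) (simp_all add: pcompose_1 pcompose_mult)

lemma degree_stepanov_poly:
  assumes "finite A"
  shows "degree (stepanov_poly A lam n r) \<le> n + r"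
  unfolding stepanov_poly_def
proof (rule degree_sum_le[OF assms])
  fix a assume "a \<in> A"
  have "degree ([:lam, a:] ^ n) \<le> n"
    using degree_power_le[of "[:lam, a:]" n] by (auto split: if_splits)
  hence "degree ([:lam, a:] ^ n * [:- a, 1:] ^ r) \<le> n + r"
    using degree_mult_le[of "[:lam, a:] ^ n" "[:- a, 1:] ^ r"] degree_linear_power[of "- a" r]
    by linarith
  thus "degree (smult (divdiff_weight A a) ([:lam, a:] ^ n * [:- a, 1:] ^ r)) \<le> n + r"
    using degree_smult_le order.trans by blast
qed

lemma coeff_shifted_stepanov_poly:
  fixes A :: "'a::field set"
  assumes fin: "finite A" and card: "e + r + 2 \<le> card A" and re: "r < e" and sr: "s \<le> r"
    and b: "b \<in> A"
    and pow: "\<And>a. a \<in> A \<Longrightarrow> a \<noteq> b \<Longrightarrow> (a * b + lam) ^ m = 1 \<or> a * b + lam = 0"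
  shows "coeff (pcompose (stepanov_poly A lam (m + e) r) [:b, 1:]) s =
    (if s = r then divdiff_weight A b * ((b * b + lam) ^ e * ((b * b + lam) ^ m - 1)) else 0)"
proof -
  \<comment> \<open>\<open>C\<close> keeps the binomials of exponent \<open>m + e\<close> for every
    \<open>j\<close>. Thus \<open>T (m + e) a\<close> is the true Taylor coefficient, while
    \<open>T e a\<close> only lowers the power of \<open>a * b + lam\<close>, making it a polynomial
    in \<open>a\<close> of degree at most \<open>e + r\<close>.\<close>
  define C :: "nat \<Rightarrow> 'a" where "C k = of_nat ((m + e) choose k) * of_nat (r choose (s - k))" for k
  define T where "T j a = (\<Sum>k\<le>s. C k * (a ^ k * (a * b + lam) ^ (j - k) * (b - a) ^ (r - (s - k))))"
    for j a
  define P where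
    "P = (\<Sum>k\<le>s. smult (C k) ([:0, 1:] ^ k * [:lam, b:] ^ (e - k) * [:b, -1:] ^ (r - (s - k))))"
  \<comment> \<open>The factor \<open>(b - b) ^ (r - (s - k))\<close> survives only as
    \<open>0 ^ 0\<close>, that is for \<open>s = r\<close> and \<open>k = 0\<close>, where
    \<open>C 0 = 1\<close>.\<close>
  have T_diag: "T j b = (if s = r then (b * b + lam) ^ j else 0)" for j
  proof -
    have "T j b = (\<Sum>k\<le>s. if k = 0 then (if s = r then (b * b + lam) ^ j else 0) else 0)"
      unfolding T_def
    proof (intro sum.cong refl)
      fix k assume "k \<in> {..s}"
      hence "k \<le> s" by simp
      hence "r - (s - k) = 0 \<longleftrightarrow> s = r \<and> k = 0" using sr by auto
      thus "C k * (b ^ k * (b * b + lam) ^ (j - k) * (b - b) ^ (r - (s - k))) =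
          (if k = 0 then (if s = r then (b * b + lam) ^ j else 0) else 0)"
        by (auto simp: C_def power_0_left)
    qed
    thus ?thesis by simp
  qed
  have "pcompose (stepanov_poly A lam (m + e) r) [:b, 1:] =
      (\<Sum>a\<in>A. smult (divdiff_weight A a) ([:a * b + lam, a:] ^ (m + e) * [:b - a, 1:] ^ r))"
    by (simp add: stepanov_poly_def pcompose_sum pcompose_smult pcompose_mult pcompose_power
        pcompose_pCons algebra_simps)
  also have "coeff \<dots> s = (\<Sum>a\<in>A. divdiff_weight A a * T (m + e) a)"
    unfolding coeff_sum coeff_smult coeff_mult T_def C_def using re sr
    by (intro sum.cong refl arg_cong[where f = "(*) (divdiff_weight A a)" for a])
       (auto simp: coeff_linear_poly_power mult_ac)
  also have "\<dots> = (\<Sum>a\<in>A. divdiff_weight A a * T e a)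
      + (\<Sum>a\<in>A. divdiff_weight A a * (T (m + e) a - T e a))"
    by (simp add: algebra_simps flip: sum.distrib)
  also have "(\<Sum>a\<in>A. divdiff_weight A a * T e a) = 0"
  proof -
    have "poly P a = T e a" for a
      by (simp add: P_def T_def poly_sum algebra_simps)
    moreover have "degree P \<le> e + r"
      unfolding P_def
    proof (rule degree_sum_le)
      fix k assume "k \<in> {..s}"
      hence k: "k \<le> s" by simp
      have "degree ([:lam, b:] ^ (e - k)) \<le> e - k"
        using degree_power_le[of "[:lam, b:]" "e - k"] by (auto split: if_splits)
      moreover have "degree ([:0, 1 :: 'a:] ^ k) = k"
        by (rule degree_linear_power)
      moreover have "degree ([:b, -1:] ^ (r - (s - k))) = r - (s - k)"
        by (rule degree_linear_power_neg)
      ultimately have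
        "degree ([:0, 1:] ^ k * [:lam, b:] ^ (e - k) * [:b, -1:] ^ (r - (s - k)))
          \<le> k + (e - k) + (r - (s - k))"
        by (intro order.trans[OF degree_mult_le] add_mono) auto
      also have "\<dots> \<le> e + r" using k re sr by linarith
      finally show "degree (smult (C k)
          ([:0, 1:] ^ k * [:lam, b:] ^ (e - k) * [:b, -1:] ^ (r - (s - k)))) \<le> e + r"
        using degree_smult_le order.trans by blast
    qed simp
    ultimately show ?thesis
      using sum_divdiff_weight_eq_0[OF fin, of P] card by simp
  qed
  also have "(\<Sum>a\<in>A. divdiff_weight A a * (T (m + e) a - T e a))
      = divdiff_weight A b * (T (m + e) b - T e b)"
  proof -
    have "T (m + e) a = T e a" if a: "a \<in> A - {b}" for a
    proof -
      have "(a * b + lam) ^ (m + e - k) = (a * b + lam) ^ (e - k)" if "k \<le> s" for k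
      proof -
        \<comment> \<open>Strictness matters: if \<open>a * b + lam = 0\<close>, both powers vanish
          only because \<open>e - k\<close> is positive.\<close>
        have "k < e" using that sr re by linarith
        hence split: "m + e - k = m + (e - k)" and "e - k > 0" by auto
        thus ?thesis unfolding split power_add using pow[of a] a by (auto simp: power_0_left)
      qed
      thus ?thesis unfolding T_def by (intro sum.cong) auto
    qed
    thus ?thesis using fin b by (subst sum.remove[of _ b]) auto
  qed
  finally show ?thesis
    by (simp add: T_diag power_add right_diff_distrib mult_ac)
qed

text \<open>Composition with \<open>[:b, 1:]\<close> is a ring automorphism taking
  \<open>[:- b, 1:]\<close> to \<open>X\<close>. Shifted coefficients replace derivatives, whose
  factorials may vanish in positive characteristic.\<close>

lemma linear_power_dvd_iff_coeff_pcompose: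
  fixes p :: "'a::field poly"
  shows "[:- b, 1:] ^ n dvd p \<longleftrightarrow> (\<forall>k<n. coeff (pcompose p [:b, 1:]) k = 0)"
proof -
  have shift: "pcompose (pcompose p [:b, 1:]) [:- b, 1:] = p" for p :: "'a poly"
    by (simp flip: pcompose_assoc add: pcompose_pCons)
  have X: "monom 1 n = [:0, 1 :: 'a:] ^ n"
    by (simp add: monom_altdef)
  have "[:- b, 1:] ^ n dvd p \<longleftrightarrow> monom 1 n dvd pcompose p [:b, 1:]"
  proof
    assume "[:- b, 1:] ^ n dvd p"
    then obtain t where "p = [:- b, 1:] ^ n * t" by (auto simp: dvd_def)
    thus "monom 1 n dvd pcompose p [:b, 1:]"
      by (simp add: pcompose_mult pcompose_power pcompose_pCons X)
  next
    assume "monom 1 n dvd pcompose p [:b, 1:]"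
    then obtain t where "pcompose p [:b, 1:] = monom 1 n * t" by (auto simp: dvd_def)
    hence "pcompose (pcompose p [:b, 1:]) [:- b, 1:] = pcompose (monom 1 n * t) [:- b, 1:]"
      by simp
    thus "[:- b, 1:] ^ n dvd p"
      by (simp add: shift pcompose_mult pcompose_power pcompose_pCons X)
  qed
  thus ?thesis by (simp add: monom_1_dvd_iff')
qed

lemma card_mult_le_degree:
  fixes p :: "'a::idom poly"
  assumes "finite A" "p \<noteq> 0" "\<And>b. b \<in> A \<Longrightarrow> [:- b, 1:] ^ r dvd p"
  shows "card A * r \<le> degree p"
proof -
  have "repeat_mset r (mset_set A) \<subseteq># proots p"
  proof (rule mset_subset_eqI)
    fix b
    show "count (repeat_mset r (mset_set A)) b \<le> count (proots p) b"
      using assms by (cases "b \<in> A") (auto simp: order_divides)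
  qed
  hence "size (repeat_mset r (mset_set A)) \<le> degree p"
    using size_mset_mono size_proots_le order.trans by blast
  thus ?thesis by (simp add: mult.commute)
qed

lemma power_card_minus_one_eq_1:
  fixes x :: "'a::{field,finite}"
  assumes "x \<noteq> 0"
  shows "x ^ (CARD('a) - 1) = 1"
proof -
  let ?U = "UNIV - {0 :: 'a}"
  have "(\<Prod>y\<in>?U. y) = (\<Prod>y\<in>?U. x * y)"
    using assms
    by (intro prod.reindex_bij_witness[of _ "\<lambda>y. x * y" "\<lambda>y. y / x"]) auto
  also have "\<dots> = x ^ (CARD('a) - 1) * (\<Prod>y\<in>?U. y)"
    by (simp add: prod.distrib)
  finally show ?thesis by simp
qed

text \<open>The inclusion is Fermat's little theorem for the field. Equality is by counting: the
  fibres of \<open>x ^ d\<close> on the \<open>d * m\<close> units have at most \<open>d\<close>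
  elements, so there are at least \<open>m\<close> powers, and at most \<open>m\<close>
  roots.\<close>

lemma dth_powers_eq_roots:
  assumes d: "d > 0" and q: "CARD('a::{field,finite}) - 1 = d * m" and m: "m > 0"
  shows "dth_powers d = {x :: 'a. x ^ m = 1}"
proof (rule card_subset_eq)
  let ?U = "UNIV - {0 :: 'a}"
  show sub: "dth_powers d \<subseteq> {x :: 'a. x ^ m = 1}"
    using power_card_minus_one_eq_1[where ?'a = 'a] q
    by (auto simp: dth_powers_def simp flip: power_mult)
  have roots: "card {x :: 'a. x ^ n = c} \<le> n" if "n > 0" for n and c :: 'a
  proof -
    have deg: "degree (monom 1 n - [:c:]) = n"
      using that degree_add_eq_left[of "- [:c:]" "monom 1 n"]
      by (simp add: degree_monom_eq diff_conv_add_uminus del: add_uminus_conv_diff)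
    hence "monom 1 n - [:c:] \<noteq> 0" using that by auto
    from card_poly_roots_bound[OF this] show ?thesis
      by (simp add: deg poly_monom)
  qed
  have "?U = (\<Union>y\<in>dth_powers d. {x \<in> ?U. x ^ d = y})"
    by (auto simp: dth_powers_def)
  hence "card ?U \<le> (\<Sum>y\<in>dth_powers d. card {x \<in> ?U. x ^ d = y})"
    using card_UN_le[of "dth_powers d" "\<lambda>y. {x \<in> ?U. x ^ d = y}"] by (metis finite)
  also have "\<dots> \<le> (\<Sum>y\<in>(dth_powers d :: 'a set). d)"
    by (intro sum_mono order.trans[OF card_mono roots[OF d]]) auto
  finally have "d * m \<le> d * card (dth_powers d :: 'a set)"
    using q by (simp add: mult.commute)
  hence "m \<le> card (dth_powers d :: 'a set)" using d by simp
  moreover have "card (dth_powers d :: 'a set) \<le> card {x :: 'a. x ^ m = 1}"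
    by (intro card_mono sub) simp
  ultimately show "card (dth_powers d :: 'a set) = card {x :: 'a. x ^ m = 1}"
    using roots[OF m, of 1] by linarith
qed simp

theorem theorem4p2:
  fixes d q :: nat and A' :: "'a::{field,finite} set" and lam :: 'a
  assumes "d \<ge> 2"
    and "CARD('a) = q"
    and "[q = 1] (mod d)"
    and "A' \<subseteq> UNIV - {0}"
    and "lam \<noteq> 0"
    and "\<forall>a\<in>A'. \<forall>b\<in>A'. a \<noteq> b \<longrightarrow> a * b + lam \<in> dth_powers d \<union> {0}"
    and "\<exists>a\<in>A'. \<exists>b\<in>A'. a * b + lam \<notin> dth_powers d \<union> {0}"
  shows "real (card A') \<le> sqrt (2 * (real q - 1) / real d) + 4"
proof -
  have "card {0, 1 :: 'a} \<le> CARD('a)" by (intro card_mono) auto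
  hence q2: "q \<ge> 2" using assms(2) by simp
  obtain m where m: "q - 1 = d * m"
    using assms(3) q2 by (auto simp: cong_altdef_nat dvd_def cong_sym_eq)
  have m0: "m > 0" using m q2 by (cases m) auto
  have S: "dth_powers d = {x :: 'a. x ^ m = 1}"
    using dth_powers_eq_roots[where ?'a = 'a, of d m] assms(1,2) m m0 by simp
  have "real q - 1 = real d * real m"
    using m q2 by (metis of_nat_1 of_nat_diff of_nat_mult one_le_numeral order.trans)
  hence rm: "2 * (real q - 1) / real d = 2 * real m"
    using assms(1) by simp
  show ?thesis
  proof (cases "card A' \<le> 4")
    case True
    thus ?thesis using rm by (simp add: add_increasing)
  next
    case False
    \<comment> \<open>The largest \<open>r\<close> with \<open>2 * r + 3\<close> at most
      \<open>card A'\<close>. The exponent \<open>e = r + 1\<close> is the least one with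
      \<open>r < e\<close>.\<close>
    define r where "r = (card A' - 3) div 2"
    define f where "f = stepanov_poly A' lam (m + (r + 1)) r"
    have card: "r + 1 + r + 2 \<le> card A'" "card A' \<le> 2 * r + 4"
      using False by (auto simp: r_def)
    have pow: "(a * b + lam) ^ m = 1 \<or> a * b + lam = 0" if "a \<in> A'" "b \<in> A'" "a \<noteq> b" for a b
      using assms(6) that by (auto simp: S)
    have taylor: "coeff (pcompose f [:b, 1:]) s = (if s = r then divdiff_weight A' b *
        ((b * b + lam) ^ (r + 1) * ((b * b + lam) ^ m - 1)) else 0)" if "b \<in> A'" "s \<le> r" for b s
      unfolding f_def using that card pow
      by (intro coeff_shifted_stepanov_poly) auto
    \<comment> \<open>Pairs of distinct elements are excluded by hypothesis, so the exceptional pair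
      is diagonal.\<close>
    obtain b where b: "b \<in> A'" "b * b + lam \<notin> dth_powers d \<union> {0}"
      using assms(6,7) by metis
    have "coeff (pcompose f [:b, 1:]) r \<noteq> 0"
      using taylor[OF b(1), of r] b(2) divdiff_weight_nonzero[of A' b] by (simp add: S)
    hence "f \<noteq> 0" by auto
    moreover have "[:- b, 1:] ^ r dvd f" if "b \<in> A'" for b
      using taylor[OF that] by (simp add: linear_power_dvd_iff_coeff_pcompose)
    ultimately have "card A' * r \<le> degree f"
      by (intro card_mult_le_degree) auto
    also have "\<dots> \<le> m + (r + 1) + r"
      unfolding f_def by (intro degree_stepanov_poly) simp
    finally have "real (card A' * r) \<le> real (m + 2 * r + 1)"
      by (simp only: of_nat_le_iff)
    hence "(real (card A') - 2) * real r \<le> real m + 1"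
      by (simp add: algebra_simps)
    moreover have "(real (card A') - 2) * (real (card A') - 4) \<le> (real (card A') - 2) * (2 * real r)"
      using card False by (intro mult_left_mono) auto
    \<comment> \<open>With \<open>n = card A'\<close>, this completes the square:
      \<open>(n - 2) * (n - 4)\<close> is one less than the square of \<open>n - 3\<close>.\<close>
    ultimately have "(real (card A') - 3)\<^sup>2 \<le> 2 * real m + 3"
      by (simp add: algebra_simps power2_eq_square)
    \<comment> \<open>The surplus 2 is absorbed by the cross term \<open>2 * sqrt (2 * m)\<close>,
      as \<open>m\<close> is at least 1.\<close>
    also have "\<dots> \<le> (sqrt (2 * real m) + 1)\<^sup>2"
      using m0 by (simp add: power2_sum real_le_rsqrt)
    finally have "real (card A') - 3 \<le> sqrt (2 * real m) + 1"
      by (rule power2_le_imp_le) simp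
    thus ?thesis unfolding rm by simp
  qed
qed

end
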